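(* Let $0<\gamma\le1$. There exist a Banach space $X$, a $\gamma$-Banach space $Y$ and a nonzero bounded linear operator $T:X\to Y$ such that $$e_k(T)=2^{1-1/\gamma}\|T\|\qquad\text{for all } k\in\mathbb N .$$
   Context: All vector spaces are real. For $\gamma\in(0,1]$, a $\gamma$-norm on a vector space $Y$ is a function $\|\cdot|Y\|:Y\to[0,\infty)$ that vanishes only at $0$, is absolutely homogeneous, and satisfies $\|x+y|Y\|^\gamma\le\|x|Y\|^\gamma+\|y|Y\|^\gamma$ for all $x,y\in Y$. A $\gamma$-Banach space is a vector space that is complete with respect to a given $\gamma$-norm. $B_X$ denotes the closed unit ball of $X$, and $\|T\|=\sup_{x\in B_X}\|Tx|Y\|$. For a bounded linear operator $T:X\to Y$ and $k\in\mathbb N=\{1,2,\dots\}$, the $k$-th (outer) entropy number $e_k(T)$ is the infimum of all $\varepsilon>0$ such that $T(B_X)$ can be covered by $2^{k-1}$ balls $y+\varepsilon B_Y$ ($y\in Y$) in $Y$ of radius $\varepsilon$. *)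

theory Defs
  imports "HOL-Analysis.Analysis" "HOL-Library.Function_Algebras"
begin

(* A space is given by a carrier S, a linear subspace of a real_vector type, and a norm
   N that is only constrained on S. Subspaces rather than type classes are used so
   that spaces (and exponents) can be quantified inside a formula. *)

locale gamma_normed_space =
  fixes \<gamma> :: real and S :: "'a::real_vector set" and N :: "'a \<Rightarrow> real"
  assumes gamma_pos: "0 < \<gamma>" and gamma_le_1: "\<gamma> \<le> 1"
    and subspace: "subspace S"
    and nonneg: "x \<in> S \<Longrightarrow> 0 \<le> N x"
    and zero_only: "x \<in> S \<Longrightarrow> N x = 0 \<Longrightarrow> x = 0"
    and homogeneous: "x \<in> S \<Longrightarrow> N (c *\<^sub>R x) = \<bar>c\<bar> * N x"
    and gamma_triangle: "x \<in> S \<Longrightarrow> y \<in> S \<Longrightarrow> N (x + y) powr \<gamma> \<le> N x powr \<gamma> + N y powr \<gamma>"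

locale gamma_banach_space = gamma_normed_space +
  assumes complete:
    "\<lbrakk>\<forall>n. s n \<in> S; \<forall>e>0. \<exists>M. \<forall>m\<ge>M. \<forall>n\<ge>M. N (s m - s n) < e\<rbrakk>
      \<Longrightarrow> \<exists>l\<in>S. (\<lambda>n. N (s n - l)) \<longlonglongrightarrow> 0"

abbreviation banach_space :: "'a::real_vector set \<Rightarrow> ('a \<Rightarrow> real) \<Rightarrow> bool" where
  "banach_space \<equiv> gamma_banach_space 1"

definition unit_ball :: "'a::real_vector set \<Rightarrow> ('a \<Rightarrow> real) \<Rightarrow> 'a set" where
  "unit_ball S N = {x \<in> S. N x \<le> 1}"

definition bounded_operator ::
  "'a::real_vector set \<Rightarrow> ('a \<Rightarrow> real) \<Rightarrow> 'b::real_vector set \<Rightarrow> ('b \<Rightarrow> real) \<Rightarrow> ('a \<Rightarrow> 'b) \<Rightarrow> bool" where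
  "bounded_operator X NX Y NY T \<longleftrightarrow>
     (\<forall>x\<in>X. T x \<in> Y) \<and>
     (\<forall>x\<in>X. \<forall>x'\<in>X. T (x + x') = T x + T x') \<and>
     (\<forall>c. \<forall>x\<in>X. T (c *\<^sub>R x) = c *\<^sub>R T x) \<and>
     (\<exists>C. \<forall>x\<in>X. NY (T x) \<le> C * NX x)"

definition operator_norm ::
  "'a::real_vector set \<Rightarrow> ('a \<Rightarrow> real) \<Rightarrow> ('b \<Rightarrow> real) \<Rightarrow> ('a \<Rightarrow> 'b) \<Rightarrow> real" where
  "operator_norm X NX NY T = (SUP x\<in>unit_ball X NX. NY (T x))"

(* Only meaningful for k \<ge> 1. The centres y j need not be distinct. *)
definition entropy_number ::
  "nat \<Rightarrow> 'a::real_vector set \<Rightarrow> ('a \<Rightarrow> real) \<Rightarrow> 'b::real_vector set \<Rightarrow> ('b \<Rightarrow> real) \<Rightarrow> ('a \<Rightarrow> 'b) \<Rightarrow> real" where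
  "entropy_number k X NX Y NY T =
     Inf {\<epsilon>. 0 < \<epsilon> \<and> (\<exists>y::nat \<Rightarrow> 'b. (\<forall>j<2 ^ (k - 1). y j \<in> Y) \<and>
            T ` unit_ball X NX \<subseteq> (\<Union>j<2 ^ (k - 1). (\<lambda>b. y j + \<epsilon> *\<^sub>R b) ` unit_ball Y NY))}"

(* Pointwise real vector space structure on functions. Every real vector space of
   dimension at most the continuum is isomorphic to a subspace of nat \<Rightarrow> real. *)
instantiation "fun" :: (type, real_vector) real_vector
begin

definition scaleR_fun :: "real \<Rightarrow> ('a \<Rightarrow> 'b) \<Rightarrow> 'a \<Rightarrow> 'b" where
  "scaleR_fun c f = (\<lambda>x. c *\<^sub>R f x)"

instance
  by standard (auto simp: scaleR_fun_def fun_eq_iff scaleR_add_right scaleR_add_left)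

end

lemma gamma_normed_space_1_iff:
  "gamma_normed_space 1 S N \<longleftrightarrow>
     subspace S \<and> (\<forall>x\<in>S. 0 \<le> N x) \<and> (\<forall>x\<in>S. N x = 0 \<longrightarrow> x = 0) \<and>
     (\<forall>c. \<forall>x\<in>S. N (c *\<^sub>R x) = \<bar>c\<bar> * N x) \<and> (\<forall>x\<in>S. \<forall>y\<in>S. N (x + y) \<le> N x + N y)"
  by (auto simp: gamma_normed_space_def subspace_add)

lemma banach_space_UNIV: "banach_space (UNIV :: 'a::banach set) norm"
proof -
  have "\<exists>l. (\<lambda>n. norm (s n - l)) \<longlonglongrightarrow> 0"
    if "\<forall>e>0. \<exists>M. \<forall>m\<ge>M. \<forall>n\<ge>M. norm (s m - s n) < e" for s :: "nat \<Rightarrow> 'a"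
  proof -
    have "Cauchy s"
      using that by (simp add: Cauchy_iff)
    then obtain l where "s \<longlonglongrightarrow> l"
      by (auto simp: Cauchy_convergent_iff convergent_def)
    then show ?thesis
      by (auto simp: tendsto_norm_zero_iff LIM_zero_iff)
  qed
  then show ?thesis
    by (auto simp: gamma_banach_space_def gamma_banach_space_axioms_def
        gamma_normed_space_1_iff norm_triangle_ineq)
qed

end

theory Submission
  imports Defs
begin

text \<open>
  Let \<open>(S, p)\<close> be the space of bounded real sequences with the supremum norm, and \<open>f z = z 0\<close>.
  Twisting \<open>p\<close> by \<open>f\<close> gives the \<open>\<gamma>\<close>-norm \<open>N z = (((p z + f z)\<^sup>\<gamma> + (p z - f z)\<^sup>\<gamma>) / 2)\<^sup>1\<^sup>/\<^sup>\<gamma>\<close>,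
  equivalent to \<open>p\<close>, which equals \<open>p\<close> on the kernel \<open>X\<close> of \<open>f\<close>, but is \<open>2\<^sup>1\<^sup>-\<^sup>1\<^sup>/\<^sup>\<gamma> p z\<close> as soon as
  \<open>\<bar>f z\<bar> = p z\<close>. Take \<open>T\<close> to be the inclusion of \<open>(X, p)\<close> into \<open>(S, N)\<close>. If \<open>e\<close> is the
  sequence \<open>(1, 0, 0, \<dots>)\<close>, then \<open>x - e\<close> is of the second kind for every \<open>x\<close> in the unit ball
  of \<open>X\<close>, so a single ball around \<open>e\<close> suffices for the upper bound. Conversely, the unit ball
  of \<open>X\<close> contains infinitely many points at mutual distance 2; two of them lie in a common
  ball of any finite cover, and the \<open>\<gamma>\<close>-triangle inequality bounds its radius from below.
\<close>

section \<open>The power mean of \<open>p z + f z\<close> and \<open>p z - f z\<close> with exponent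
  \<open>\<gamma>\<close>\<close>

definition twisted_norm :: "real \<Rightarrow> ('a \<Rightarrow> real) \<Rightarrow> ('a \<Rightarrow> real) \<Rightarrow> 'a \<Rightarrow> real" where
  "twisted_norm \<gamma> p f z = (((p z + f z) powr \<gamma> + (p z - f z) powr \<gamma>) / 2) powr (1 / \<gamma>)"

lemma twisted_norm_nonneg: "0 \<le> twisted_norm \<gamma> p f z"
  by (simp add: twisted_norm_def)

lemma twisted_norm_powr:
  "0 < \<gamma> \<Longrightarrow> twisted_norm \<gamma> p f z powr \<gamma> = ((p z + f z) powr \<gamma> + (p z - f z) powr \<gamma>) / 2"
  by (simp add: twisted_norm_def powr_powr)

lemma twisted_norm_kernel:
  assumes "0 < \<gamma>" "f z = 0" "0 \<le> p z"
  shows "twisted_norm \<gamma> p f z = p z"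
  using assms by (simp add: twisted_norm_def powr_powr)

text \<open>One of the two summands vanishes and the other is
  \<open>(2 * p z) powr \<gamma>\<close>; the halving under the root turns the factor
  \<open>2\<close> into \<open>2 powr (1 - 1 / \<gamma>)\<close>.\<close>

lemma twisted_norm_extremal:
  assumes "0 < \<gamma>" "\<bar>f z\<bar> = p z"
  shows "twisted_norm \<gamma> p f z = 2 powr (1 - 1 / \<gamma>) * p z"
proof -
  have "f z = p z \<or> f z = - p z"
    using assms(2) by linarith
  then have "(p z + f z) powr \<gamma> + (p z - f z) powr \<gamma> = (2 * p z) powr \<gamma>"
    by auto
  then have "twisted_norm \<gamma> p f z = 2 * p z / 2 powr (1 / \<gamma>)"
    using assms by (simp add: twisted_norm_def powr_divide powr_powr)
  then show ?thesis
    by (simp add: powr_diff)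
qed

text \<open>A number in [0, 1] does not decrease under a positive exponent at most 1. This is
  applied to the shares \<open>a / (a + b)\<close> and \<open>b / (a + b)\<close>, whose sum is
  1.\<close>

lemma powr_add_le:
  fixes a b \<gamma> :: real
  assumes "0 \<le> a" "0 \<le> b" "0 < \<gamma>" "\<gamma> \<le> 1"
  shows "(a + b) powr \<gamma> \<le> a powr \<gamma> + b powr \<gamma>"
proof (cases "a = 0 \<or> b = 0")
  case False
  then have pos: "0 < a" "0 < b" using assms by auto
  have scale: "c / (a + b) * (a + b) powr \<gamma> \<le> c powr \<gamma>" if "0 < c" "c \<le> a + b" for c
  proof -
    have "c / (a + b) \<le> (c / (a + b)) powr \<gamma>"
      using powr_mono'[of \<gamma> 1 "c / (a + b)"] that assms by simp
    then have "c / (a + b) * (a + b) powr \<gamma> \<le> (c / (a + b)) powr \<gamma> * (a + b) powr \<gamma>"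
      by (intro mult_right_mono) auto
    also have "\<dots> = c powr \<gamma>"
      using that by (simp add: powr_divide)
    finally show ?thesis .
  qed
  have "(a + b) powr \<gamma> = a / (a + b) * (a + b) powr \<gamma> + b / (a + b) * (a + b) powr \<gamma>"
    using pos by (simp flip: distrib_right add_divide_distrib)
  also have "\<dots> \<le> a powr \<gamma> + b powr \<gamma>"
    using scale[of a] scale[of b] pos by linarith
  finally show ?thesis .
qed auto

section \<open>Twisting a Banach norm by a functional of norm at most one\<close>

locale banach_functional = gamma_banach_space 1 S p
  for S :: "'a::real_vector set" and p +
  fixes f :: "'a \<Rightarrow> real"
  assumes f_add: "x \<in> S \<Longrightarrow> y \<in> S \<Longrightarrow> f (x + y) = f x + f y"
    and f_scale: "x \<in> S \<Longrightarrow> f (c *\<^sub>R x) = c * f x"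
    and f_le: "x \<in> S \<Longrightarrow> \<bar>f x\<bar> \<le> p x"
begin

lemma p_triangle: "x \<in> S \<Longrightarrow> y \<in> S \<Longrightarrow> p (x + y) \<le> p x + p y"
  using gamma_triangle[of x y] nonneg subspace by (simp add: subspace_add)

lemma f_diff: "x \<in> S \<Longrightarrow> y \<in> S \<Longrightarrow> f (x - y) = f x - f y"
  using f_add[of "x - y" y] subspace by (simp add: subspace_diff)

text \<open>The kernel is closed: since \<open>f (s n) = 0\<close>, the limit satisfies
  \<open>\<bar>f l\<bar> \<le> p (s n - l)\<close>, and the right side tends to 0.\<close>

lemma kernel_banach: "banach_space {x \<in> S. f x = 0} p"
proof -
  have f0: "f 0 = 0"
    using f_scale[of 0 0] subspace by (simp add: subspace_0)
  have "subspace {x \<in> S. f x = 0}"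
    using subspace by (auto simp: subspace_def f_add f_scale f0)
  moreover have "\<exists>l\<in>{x \<in> S. f x = 0}. (\<lambda>n. p (s n - l)) \<longlonglongrightarrow> 0"
    if s: "\<forall>n. s n \<in> {x \<in> S. f x = 0}"
      and cauchy: "\<forall>e>0. \<exists>M. \<forall>m\<ge>M. \<forall>n\<ge>M. p (s m - s n) < e" for s
  proof -
    obtain l where l: "l \<in> S" "(\<lambda>n. p (s n - l)) \<longlonglongrightarrow> 0"
      using complete[of s] s cauchy by blast
    have "\<bar>f l\<bar> \<le> p (s n - l)" for n
      using f_le[of "s n - l"] s l subspace by (simp add: f_diff subspace_diff)
    then have "\<bar>f l\<bar> \<le> 0"
      using l(2) by (intro LIMSEQ_le_const) auto
    with l show ?thesis by auto
  qed
  ultimately show ?thesis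
    using nonneg zero_only homogeneous p_triangle
    by (auto simp: gamma_banach_space_def gamma_banach_space_axioms_def gamma_normed_space_1_iff)
qed

text \<open>By \<open>f_le\<close>, both \<open>p x + f x\<close> and \<open>p x - f x\<close> are
  at most \<open>2 * p x\<close>, hence so is their power mean.\<close>

lemma twisted_norm_upper:
  assumes "0 < \<gamma>" "x \<in> S"
  shows "twisted_norm \<gamma> p f x \<le> 2 * p x"
proof -
  have "(p x + f x) powr \<gamma> \<le> (2 * p x) powr \<gamma>" "(p x - f x) powr \<gamma> \<le> (2 * p x) powr \<gamma>"
    using f_le[OF assms(2)] assms(1) by (auto intro!: powr_mono2)
  then have "twisted_norm \<gamma> p f x powr \<gamma> \<le> (2 * p x) powr \<gamma>"
    using assms by (simp add: twisted_norm_powr)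
  then show ?thesis
    using assms nonneg[of x] twisted_norm_nonneg[of \<gamma> p f x]
    by (meson linorder_not_le mult_nonneg_nonneg powr_less_mono2 zero_le_numeral)
qed

text \<open>One of the two summands is \<open>(p x + \<bar>f x\<bar>) powr \<gamma>\<close>; the
  factor \<open>2 powr (1 / \<gamma>)\<close> undoes the halving of the sum.\<close>

lemma twisted_norm_lower:
  assumes "0 < \<gamma>" "x \<in> S"
  shows "p x \<le> 2 powr (1 / \<gamma>) * twisted_norm \<gamma> p f x"
proof -
  have "p x powr \<gamma> \<le> (p x + \<bar>f x\<bar>) powr \<gamma>"
    using nonneg[OF assms(2)] assms(1) by (intro powr_mono2) auto
  also have "\<dots> \<le> (p x + f x) powr \<gamma> + (p x - f x) powr \<gamma>"
    by (cases "0 \<le> f x") auto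
  also have "\<dots> = (2 powr (1 / \<gamma>) * twisted_norm \<gamma> p f x) powr \<gamma>"
    using assms twisted_norm_nonneg[of \<gamma> p f x]
    by (simp add: twisted_norm_powr powr_mult powr_powr)
  finally show ?thesis
    using assms nonneg[of x] twisted_norm_nonneg[of \<gamma> p f x]
    by (meson linorder_not_le mult_nonneg_nonneg powr_less_mono2 powr_ge_zero)
qed

text \<open>A negative \<open>c\<close> interchanges the two summands, which leaves their sum
  unchanged.\<close>

lemma twisted_norm_scale:
  assumes "0 < \<gamma>" "x \<in> S"
  shows "twisted_norm \<gamma> p f (c *\<^sub>R x) = \<bar>c\<bar> * twisted_norm \<gamma> p f x"
proof -
  have ge: "0 \<le> p x + f x" "0 \<le> p x - f x"
    using f_le[OF assms(2)] by auto
  have "(\<bar>c\<bar> * p x + c * f x) powr \<gamma> + (\<bar>c\<bar> * p x - c * f x) powr \<gamma>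
      = (\<bar>c\<bar> * (p x + f x)) powr \<gamma> + (\<bar>c\<bar> * (p x - f x)) powr \<gamma>"
  proof (cases "0 \<le> c")
    case False
    then have "\<bar>c\<bar> * p x + c * f x = \<bar>c\<bar> * (p x - f x)" "\<bar>c\<bar> * p x - c * f x = \<bar>c\<bar> * (p x + f x)"
      by (simp_all add: algebra_simps)
    then show ?thesis by simp
  qed (simp add: algebra_simps)
  also have "\<dots> = \<bar>c\<bar> powr \<gamma> * ((p x + f x) powr \<gamma> + (p x - f x) powr \<gamma>)"
    using ge by (simp add: powr_mult flip: distrib_left)
  finally show ?thesis
    using assms
    by (simp add: twisted_norm_def homogeneous f_scale powr_mult powr_divide powr_powr)
qed

text \<open>
  In the coordinates \<open>a = p z + f z\<close> and \<open>b = p z - f z\<close>, both of which are nonnegative and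
  subadditive, the triangle inequality is that of the scalar function \<open>t\<^sup>\<gamma>\<close>.
\<close>

lemma twisted_norm_triangle:
  assumes "0 < \<gamma>" "\<gamma> \<le> 1" "x \<in> S" "y \<in> S"
  shows "twisted_norm \<gamma> p f (x + y) powr \<gamma>
         \<le> twisted_norm \<gamma> p f x powr \<gamma> + twisted_norm \<gamma> p f y powr \<gamma>"
proof -
  have ge: "0 \<le> p z + f z" "0 \<le> p z - f z" if "z \<in> S" for z
    using f_le[OF that] by auto
  have xy: "x + y \<in> S"
    using assms subspace by (simp add: subspace_add)
  have "(p (x + y) + f (x + y)) powr \<gamma> \<le> ((p x + f x) + (p y + f y)) powr \<gamma>"
    using ge[OF xy] p_triangle[of x y] f_add[of x y] assms by (intro powr_mono2) auto
  also have "\<dots> \<le> (p x + f x) powr \<gamma> + (p y + f y) powr \<gamma>"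
    using assms ge by (intro powr_add_le) auto
  finally have plus: "(p (x + y) + f (x + y)) powr \<gamma> \<le> (p x + f x) powr \<gamma> + (p y + f y) powr \<gamma>" .
  have "(p (x + y) - f (x + y)) powr \<gamma> \<le> ((p x - f x) + (p y - f y)) powr \<gamma>"
    using ge[OF xy] p_triangle[of x y] f_add[of x y] assms by (intro powr_mono2) auto
  also have "\<dots> \<le> (p x - f x) powr \<gamma> + (p y - f y) powr \<gamma>"
    using assms ge by (intro powr_add_le) auto
  finally have "(p (x + y) - f (x + y)) powr \<gamma> \<le> (p x - f x) powr \<gamma> + (p y - f y) powr \<gamma>" .
  with plus show ?thesis
    unfolding twisted_norm_powr[OF assms(1)] add_divide_distrib[symmetric]
    by (intro divide_right_mono) auto
qed

text \<open>Completeness is inherited from \<open>p\<close>: \<open>twisted_norm_lower\<close> makes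
  a Cauchy sequence Cauchy for \<open>p\<close>, and \<open>twisted_norm_upper\<close> makes its
  \<open>p\<close>-limit a limit for \<open>twisted_norm\<close>.\<close>

lemma twisted_banach:
  assumes "0 < \<gamma>" "\<gamma> \<le> 1"
  shows "gamma_banach_space \<gamma> S (twisted_norm \<gamma> p f)"
proof
  let ?N = "twisted_norm \<gamma> p f"
  show "x = 0" if "x \<in> S" "?N x = 0" for x
    using twisted_norm_lower[of \<gamma> x] that assms nonneg[of x] zero_only[of x] by simp
  show "\<exists>l\<in>S. (\<lambda>n. ?N (s n - l)) \<longlonglongrightarrow> 0"
    if s: "\<forall>n. s n \<in> S"
      and cauchy: "\<forall>e>0. \<exists>M. \<forall>m\<ge>M. \<forall>n\<ge>M. ?N (s m - s n) < e" for s
  proof -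
    let ?C = "2 powr (1 / \<gamma>)"
    have "\<exists>M. \<forall>m\<ge>M. \<forall>n\<ge>M. p (s m - s n) < e" if "0 < e" for e
    proof -
      have "0 < e / ?C" using that by simp
      then obtain M where M: "\<forall>m\<ge>M. \<forall>n\<ge>M. ?N (s m - s n) < e / ?C"
        using cauchy by blast
      have "p (s m - s n) < e" if "m \<ge> M" "n \<ge> M" for m n
      proof -
        have "p (s m - s n) \<le> ?C * ?N (s m - s n)"
          using s subspace assms by (intro twisted_norm_lower) (auto simp: subspace_diff)
        also have "\<dots> < e"
          using M that by (simp add: less_divide_eq mult.commute)
        finally show ?thesis .
      qed
      then show ?thesis by blast
    qed
    then obtain l where l: "l \<in> S" "(\<lambda>n. p (s n - l)) \<longlonglongrightarrow> 0"
      using complete[of s] s by blast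
    have "(\<lambda>n. ?N (s n - l)) \<longlonglongrightarrow> 0"
    proof (rule tendsto_sandwich[where f = "\<lambda>_. 0"])
      show "\<forall>\<^sub>F n in sequentially. ?N (s n - l) \<le> 2 * p (s n - l)"
        using s l(1) subspace assms
        by (intro always_eventually allI twisted_norm_upper) (auto simp: subspace_diff)
      show "(\<lambda>n. 2 * p (s n - l)) \<longlonglongrightarrow> 0"
        using tendsto_mult_left[OF l(2), of 2] by simp
    qed (auto simp: twisted_norm_nonneg)
    with l show ?thesis by blast
  qed
qed (use assms subspace in \<open>auto simp: twisted_norm_nonneg twisted_norm_scale twisted_norm_triangle\<close>)

end

section \<open>Covering a separated sequence by finitely many balls\<close>

lemma (in gamma_normed_space) finite_cover_radius_ge:
  fixes a :: "nat \<Rightarrow> 'a" and y :: "nat \<Rightarrow> 'a"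
  assumes "0 < \<epsilon>" and "0 \<le> d" and "\<And>j. j < m \<Longrightarrow> y j \<in> S"
    and cover: "range a \<subseteq> (\<Union>j<m. (\<lambda>b. y j + \<epsilon> *\<^sub>R b) ` unit_ball S N)"
    and separated: "\<And>i i'. i \<noteq> i' \<Longrightarrow> 2 * d \<le> N (a i - a i')"
  shows "2 powr (1 - 1 / \<gamma>) * d \<le> \<epsilon>"
proof -
  have "\<forall>i. \<exists>j<m. \<exists>b\<in>unit_ball S N. a i = y j + \<epsilon> *\<^sub>R b"
    using cover by (force simp: image_subset_iff)
  then obtain J b where J: "\<And>i. J i < m" and b: "\<And>i. b i \<in> unit_ball S N"
    and a: "\<And>i. a i = y (J i) + \<epsilon> *\<^sub>R b i"
    by metis
  \<comment> \<open>Pigeonhole on the indices: infinitely many points are distributed over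
    \<open>m\<close> balls, for any \<open>m\<close>.\<close>
  have "\<not> inj J"
    using J finite_imageD[of J UNIV] finite_subset[of "range J" "{..<m}"] by auto
  then obtain i i' where ii: "J i = J i'" "i \<noteq> i'"
    by (auto simp: inj_def)
  have bS: "b i \<in> S" "b i' \<in> S" and b1: "N (b i) \<le> 1" "N (b i') \<le> 1"
    using b by (auto simp: unit_ball_def)
  \<comment> \<open>Stated for both signs of \<open>c\<close>, because the difference of two points
    is written as a sum below to fit \<open>gamma_triangle\<close>.\<close>
  have ball: "N (c *\<^sub>R x) powr \<gamma> \<le> \<epsilon> powr \<gamma>" if "\<bar>c\<bar> = \<epsilon>" "x \<in> S" "N x \<le> 1" for c x
    using that assms(1) gamma_pos nonneg[of x]
    by (intro powr_mono2) (auto simp: homogeneous mult_left_le)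
  have "a i - a i' = \<epsilon> *\<^sub>R b i + (- \<epsilon>) *\<^sub>R b i'"
    using ii by (simp add: a)
  then have "N (a i - a i') powr \<gamma> \<le> N (\<epsilon> *\<^sub>R b i) powr \<gamma> + N ((- \<epsilon>) *\<^sub>R b i') powr \<gamma>"
    using gamma_triangle[of "\<epsilon> *\<^sub>R b i" "(- \<epsilon>) *\<^sub>R b i'"] bS subspace
    by (simp only: subspace_scale)
  also have "\<dots> \<le> 2 * \<epsilon> powr \<gamma>"
    using ball[of \<epsilon> "b i"] ball[of "- \<epsilon>" "b i'"] bS b1 assms(1) by simp
  finally have "(2 * d) powr \<gamma> \<le> (2 powr (1 / \<gamma>) * \<epsilon>) powr \<gamma>"
    using separated[OF ii(2)] powr_mono2[of \<gamma> "2 * d" "N (a i - a i')"] assms gamma_pos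
    by (simp add: powr_mult powr_powr)
  \<comment> \<open>Strict monotonicity of the power on nonnegative numbers, contraposed, cancels
    the exponent.\<close>
  then have "2 * d \<le> 2 powr (1 / \<gamma>) * \<epsilon>"
    using assms gamma_pos
    by (meson linorder_not_le mult_nonneg_nonneg powr_less_mono2 powr_ge_zero less_imp_le)
  then show ?thesis
    by (simp add: powr_diff field_simps)
qed

section \<open>The Banach space of bounded sequences\<close>

definition bounded_sequences :: "(nat \<Rightarrow> real) set" where
  "bounded_sequences = {z. bounded (range z)}"

definition sup_norm :: "(nat \<Rightarrow> real) \<Rightarrow> real" where
  "sup_norm z = (SUP n. \<bar>z n\<bar>)"

lemma bounded_sequencesI: "(\<And>n. \<bar>z n\<bar> \<le> B) \<Longrightarrow> z \<in> bounded_sequences"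
  by (auto simp: bounded_sequences_def bounded_iff)

lemma abs_le_sup_norm:
  assumes "z \<in> bounded_sequences"
  shows "\<bar>z n\<bar> \<le> sup_norm z"
proof -
  have "bdd_above (range (\<lambda>n. \<bar>z n\<bar>))"
    using assms by (auto simp: bounded_sequences_def bounded_iff bdd_above_def)
  then show ?thesis
    unfolding sup_norm_def by (intro cSUP_upper) auto
qed

lemma sup_norm_le: "(\<And>n. \<bar>z n\<bar> \<le> B) \<Longrightarrow> sup_norm z \<le> B"
  unfolding sup_norm_def by (intro cSUP_least) auto

lemma bounded_sequences_subspace: "subspace bounded_sequences"
proof -
  have "x + y \<in> bounded_sequences" if "x \<in> bounded_sequences" "y \<in> bounded_sequences" for x y
    using abs_le_sup_norm[OF that(1)] abs_le_sup_norm[OF that(2)]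
    by (intro bounded_sequencesI[of _ "sup_norm x + sup_norm y"])
      (auto intro: order_trans[OF abs_triangle_ineq] add_mono)
  moreover have "c *\<^sub>R x \<in> bounded_sequences" if "x \<in> bounded_sequences" for c x
    using abs_le_sup_norm[OF that]
    by (intro bounded_sequencesI[of _ "\<bar>c\<bar> * sup_norm x"])
      (auto simp: scaleR_fun_def abs_mult mult_left_mono)
  ultimately show ?thesis
    using bounded_sequencesI[of 0 0] by (auto simp: subspace_def)
qed

lemma sup_norm_nonneg: "x \<in> bounded_sequences \<Longrightarrow> 0 \<le> sup_norm x"
  using abs_le_sup_norm[of x 0] by linarith

text \<open>The inequality \<open>\<le>\<close> suffices: for \<open>c \<noteq> 0\<close>, its
  instance with \<open>1 / c\<close> and \<open>c *\<^sub>R x\<close> is the reverse one.\<close>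

lemma sup_norm_scale:
  assumes "x \<in> bounded_sequences"
  shows "sup_norm (c *\<^sub>R x) = \<bar>c\<bar> * sup_norm x"
proof -
  have le: "sup_norm (c *\<^sub>R x) \<le> \<bar>c\<bar> * sup_norm x" if "x \<in> bounded_sequences" for c x
    using abs_le_sup_norm[OF that]
    by (intro sup_norm_le) (auto simp: scaleR_fun_def abs_mult mult_left_mono)
  show ?thesis
  proof (cases "c = 0")
    case True
    then show ?thesis by (simp add: sup_norm_def)
  next
    case False
    have "sup_norm x \<le> \<bar>1 / c\<bar> * sup_norm (c *\<^sub>R x)"
      using le[of "c *\<^sub>R x" "1 / c"] assms False bounded_sequences_subspace
      by (simp add: subspace_scale)
    then show ?thesis
      using le[OF assms, of c] False by (simp add: field_simps)
  qed
qed

lemma sup_norm_triangle: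
  assumes "x \<in> bounded_sequences" "y \<in> bounded_sequences"
  shows "sup_norm (x + y) \<le> sup_norm x + sup_norm y"
  using abs_le_sup_norm[OF assms(1)] abs_le_sup_norm[OF assms(2)]
  by (intro sup_norm_le) (auto intro: order_trans[OF abs_triangle_ineq] add_mono)

lemma bounded_sequences_banach: "banach_space bounded_sequences sup_norm"
proof -
  have "x = 0" if "x \<in> bounded_sequences" "sup_norm x = 0" for x
    using abs_le_sup_norm[OF that(1)] that(2) by (simp add: fun_eq_iff)
  moreover have "\<exists>l\<in>bounded_sequences. (\<lambda>n. sup_norm (s n - l)) \<longlonglongrightarrow> 0"
    if s: "\<forall>n. s n \<in> bounded_sequences"
      and cauchy: "\<forall>e>0. \<exists>M. \<forall>m\<ge>M. \<forall>n\<ge>M. sup_norm (s m - s n) < e" for s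
  proof -
    have diff: "s m - s n \<in> bounded_sequences" for m n
      using s bounded_sequences_subspace by (simp add: subspace_diff)
    have point: "\<bar>s m k - s n k\<bar> \<le> sup_norm (s m - s n)" for m n k
      using abs_le_sup_norm[OF diff, of m n k] by simp
    have "Cauchy (\<lambda>n. s n k)" for k
      using cauchy point unfolding Cauchy_iff real_norm_def by (meson le_less_trans)
    then have "\<forall>k. \<exists>L. (\<lambda>n. s n k) \<longlonglongrightarrow> L"
      by (simp add: Cauchy_convergent_iff convergent_def)
    then obtain l where l: "\<And>k. (\<lambda>n. s n k) \<longlonglongrightarrow> l k"
      by metis
    \<comment> \<open>Letting \<open>m\<close> tend to infinity in the Cauchy estimate gives a bound
      uniform in \<open>k\<close>, which upgrades pointwise to uniform convergence.\<close>
    have near: "\<exists>M. \<forall>n\<ge>M. \<forall>k. \<bar>(s n - l) k\<bar> \<le> e" if "0 < e" for e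
    proof -
      obtain M where M: "\<forall>m\<ge>M. \<forall>n\<ge>M. sup_norm (s m - s n) < e"
        using cauchy \<open>0 < e\<close> by blast
      have "\<bar>s n k - l k\<bar> \<le> e" if "n \<ge> M" for n k
      proof (rule LIMSEQ_le_const2)
        show "(\<lambda>m. \<bar>s n k - s m k\<bar>) \<longlonglongrightarrow> \<bar>s n k - l k\<bar>"
          by (intro tendsto_intros l)
        show "\<exists>M. \<forall>m\<ge>M. \<bar>s n k - s m k\<bar> \<le> e"
          using M point that by (meson le_less_trans less_imp_le)
      qed
      then show ?thesis by auto
    qed
    obtain M where M: "\<And>k. \<bar>(s M - l) k\<bar> \<le> 1"
      using near[of 1] by auto
    \<comment> \<open>\<open>l\<close> is \<open>s M\<close> minus a sequence bounded by 1.\<close>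
    have l_bounded: "l \<in> bounded_sequences"
      using subspace_diff[OF bounded_sequences_subspace spec[OF s, of M]
          bounded_sequencesI[of "s M - l", OF M]] by simp
    then have nonneg: "0 \<le> sup_norm (s n - l)" for n
      using s bounded_sequences_subspace by (intro sup_norm_nonneg subspace_diff) auto
    have "(\<lambda>n. sup_norm (s n - l)) \<longlonglongrightarrow> 0"
    proof (rule LIMSEQ_I)
      fix e :: real
      assume "0 < e"
      \<comment> \<open>Half of \<open>e\<close>, since \<open>sup_norm_le\<close> yields only a
        non-strict bound.\<close>
      then obtain M where "\<forall>n\<ge>M. \<forall>k. \<bar>(s n - l) k\<bar> \<le> e / 2"
        using near[of "e / 2"] by auto
      then have "\<forall>n\<ge>M. sup_norm (s n - l) \<le> e / 2"
        by (blast intro: sup_norm_le)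
      then show "\<exists>M. \<forall>n\<ge>M. norm (sup_norm (s n - l) - 0) < e"
        using nonneg \<open>0 < e\<close> by (intro exI[of _ M]) fastforce
    qed
    with l_bounded show ?thesis by blast
  qed
  ultimately show ?thesis
    using bounded_sequences_subspace sup_norm_nonneg sup_norm_scale sup_norm_triangle
    by (auto simp: gamma_banach_space_def gamma_banach_space_axioms_def gamma_normed_space_1_iff)
qed

section \<open>The example: the kernel of evaluation at 0, included in the twisted space\<close>

interpretation evaluation: banach_functional bounded_sequences sup_norm "\<lambda>z. z 0"
  by (intro banach_functional.intro banach_functional_axioms.intro bounded_sequences_banach)
    (auto simp: scaleR_fun_def abs_le_sup_norm)

theorem theorem11:
  fixes \<gamma> :: real
  assumes "0 < \<gamma>" and "\<gamma> \<le> 1"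
  shows "\<exists>(X :: (nat \<Rightarrow> real) set) NX (Y :: (nat \<Rightarrow> real) set) NY T.
           banach_space X NX \<and> gamma_banach_space \<gamma> Y NY \<and>
           bounded_operator X NX Y NY T \<and> (\<exists>x\<in>X. T x \<noteq> 0) \<and>
           (\<forall>k\<ge>1. entropy_number k X NX Y NY T
                    = 2 powr (1 - 1 / \<gamma>) * operator_norm X NX NY T)"
proof -
  let ?S = bounded_sequences
  let ?X = "{z \<in> ?S. z 0 = 0}"
  define N where "N = twisted_norm \<gamma> sup_norm (\<lambda>z::nat \<Rightarrow> real. z 0)"
  define \<delta> :: real where "\<delta> = 2 powr (1 - 1 / \<gamma>)"
  \<comment> \<open>The zero at index 0 puts \<open>a i\<close> into the kernel; for
    \<open>i \<noteq> i'\<close>, the values of \<open>a i\<close> and \<open>a i'\<close> at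
    \<open>Suc i\<close> are \<open>1\<close> and \<open>- 1\<close>.\<close>
  define a :: "nat \<Rightarrow> nat \<Rightarrow> real"
    where "a i n = (if n = 0 then 0 else if n = Suc i then 1 else - 1)" for i n
  define e :: "nat \<Rightarrow> real" where "e n = (if n = 0 then 1 else 0)" for n
  interpret N: gamma_banach_space \<gamma> ?S N
    unfolding N_def using assms by (rule evaluation.twisted_banach)
  have \<delta>: "0 < \<delta>" by (simp add: \<delta>_def)
  have N_kernel: "N x = sup_norm x" if "x \<in> ?X" for x
    using that assms evaluation.nonneg by (auto simp: N_def intro!: twisted_norm_kernel)
  have a_X: "a i \<in> ?X" for i
    using bounded_sequencesI[of "a i" 1] by (auto simp: a_def)
  have a_le: "sup_norm (a i) \<le> 1" for i
    by (rule sup_norm_le) (auto simp: a_def)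
  have a_ge: "1 \<le> sup_norm (a i)" for i
    using abs_le_sup_norm[of "a i" "Suc i"] a_X by (simp add: a_def)
  \<comment> \<open>The form \<open>2 * 1\<close> matches the separation \<open>2 * d\<close> with
    \<open>d = 1\<close>.\<close>
  have a_diff: "2 * 1 \<le> N (a i - a i')" if "i \<noteq> i'" for i i'
  proof -
    have "a i - a i' \<in> ?X"
      using a_X evaluation.subspace by (auto simp: subspace_diff)
    then show ?thesis
      using abs_le_sup_norm[of "a i - a i'" "Suc i"] that by (simp add: N_kernel a_def)
  qed
  have e_S: "e \<in> ?S"
    using bounded_sequencesI[of e 1] by (auto simp: e_def)
  have e_dist: "N (x - e) = \<delta>" if "x \<in> unit_ball ?X sup_norm" for x
  proof -
    have x: "x \<in> ?S" "x 0 = 0" "sup_norm x \<le> 1" using that by (auto simp: unit_ball_def)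
    have le: "\<bar>(x - e) n\<bar> \<le> 1" for n
      using abs_le_sup_norm[OF x(1), of n] x by (auto simp: e_def)
    \<comment> \<open>Entry 0 of \<open>x - e\<close> is \<open>- 1\<close>, so the supremum is
      attained by the evaluation functional and the extremal case applies.\<close>
    have "1 \<le> sup_norm (x - e)"
      using abs_le_sup_norm[OF bounded_sequencesI[of "x - e", OF le], of 0] x(2) by (simp add: e_def)
    then have "sup_norm (x - e) = 1"
      using sup_norm_le[of "x - e", OF le] by simp
    then show ?thesis
      using x twisted_norm_extremal[of \<gamma> "\<lambda>z. z 0" "x - e" sup_norm] assms
      by (simp add: N_def \<delta>_def e_def)
  qed
  \<comment> \<open>\<open>id\<close> is isometric on the kernel, and the supremum is attained at
    \<open>a 0\<close>.\<close>
  have norm1: "operator_norm ?X sup_norm N id = 1"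
    unfolding operator_norm_def
  proof (rule cSup_eq_maximum)
    show "1 \<in> (\<lambda>x. N (id x)) ` unit_ball ?X sup_norm"
      using a_X[of 0] a_le[of 0] a_ge[of 0]
      by (intro image_eqI[of _ _ "a 0"]) (auto simp: N_kernel unit_ball_def)
    show "z \<le> 1" if "z \<in> (\<lambda>x. N (id x)) ` unit_ball ?X sup_norm" for z
      using that by (auto simp: N_kernel unit_ball_def)
  qed
  \<comment> \<open>The infimum is a minimum, the same for every number of balls;
    \<open>k = 0\<close> is included because \<open>k - 1\<close> is then 0.\<close>
  have entropy: "entropy_number k ?X sup_norm ?S N id = \<delta>" for k
    unfolding entropy_number_def
  proof (rule cInf_eq_minimum)
    have "unit_ball ?X sup_norm \<subseteq> (\<lambda>b. e + \<delta> *\<^sub>R b) ` unit_ball ?S N"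
    proof
      fix x assume x: "x \<in> unit_ball ?X sup_norm"
      then have d: "x - e \<in> ?S"
        using e_S evaluation.subspace by (auto simp: unit_ball_def subspace_diff)
      then have "(1 / \<delta>) *\<^sub>R (x - e) \<in> unit_ball ?S N"
        using evaluation.subspace \<delta> e_dist[OF x] N.homogeneous[OF d]
        by (simp add: unit_ball_def subspace_scale)
      moreover have "x = e + \<delta> *\<^sub>R ((1 / \<delta>) *\<^sub>R (x - e))"
        using \<delta> by simp
      ultimately show "x \<in> (\<lambda>b. e + \<delta> *\<^sub>R b) ` unit_ball ?S N"
        by blast
    qed
    then show "\<delta> \<in> {\<epsilon>. 0 < \<epsilon> \<and> (\<exists>y::nat \<Rightarrow> nat \<Rightarrow> real. (\<forall>j<2 ^ (k - 1). y j \<in> ?S) \<and>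
        id ` unit_ball ?X sup_norm \<subseteq> (\<Union>j<2 ^ (k - 1). (\<lambda>b. y j + \<epsilon> *\<^sub>R b) ` unit_ball ?S N))}"
      \<comment> \<open>All centres are chosen equal to \<open>e\<close>; there is at least one, as
        \<open>2 ^ (k - 1)\<close> is positive.\<close>
      using \<delta> e_S
      by (intro CollectI conjI exI[of _ "\<lambda>_. e"]) (simp_all add: lessThan_empty_iff bot_nat_def)
    show "\<delta> \<le> \<epsilon>" if "\<epsilon> \<in> {\<epsilon>. 0 < \<epsilon> \<and> (\<exists>y::nat \<Rightarrow> nat \<Rightarrow> real. (\<forall>j<2 ^ (k - 1). y j \<in> ?S) \<and>
        id ` unit_ball ?X sup_norm \<subseteq> (\<Union>j<2 ^ (k - 1). (\<lambda>b. y j + \<epsilon> *\<^sub>R b) ` unit_ball ?S N))}"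
      for \<epsilon>
      using that
    proof (elim CollectE conjE exE)
      fix y :: "nat \<Rightarrow> nat \<Rightarrow> real"
      assume "0 < \<epsilon>" and y: "\<forall>j<2 ^ (k - 1). y j \<in> ?S"
        and cover: "id ` unit_ball ?X sup_norm
          \<subseteq> (\<Union>j<2 ^ (k - 1). (\<lambda>b. y j + \<epsilon> *\<^sub>R b) ` unit_ball ?S N)"
      have "range a \<subseteq> id ` unit_ball ?X sup_norm"
        using a_X a_le by (auto simp: unit_ball_def)
      note a_cover = order_trans[OF this cover]
      have "2 powr (1 - 1 / \<gamma>) * 1 \<le> \<epsilon>"
        by (rule N.finite_cover_radius_ge[OF \<open>0 < \<epsilon>\<close> zero_le_one _ a_cover a_diff]) (use y in auto)
      then show ?thesis by (simp add: \<delta>_def)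
    qed
  qed
  have "bounded_operator ?X sup_norm ?S N id"
    by (auto simp: bounded_operator_def N_kernel intro!: exI[of _ 1])
  moreover have "id (a 0) \<noteq> 0"
    by (auto simp: a_def fun_eq_iff intro!: exI[of _ 1])
  ultimately show ?thesis
    using evaluation.kernel_banach N.gamma_banach_space_axioms a_X[of 0] norm1 entropy
    by (intro exI[of _ ?X] exI[of _ sup_norm] exI[of _ ?S] exI[of _ N] exI[of _ id])
      (auto simp: \<delta>_def)
qed

end
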